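(* Let $A\in\mathbb{R}^{n\times n}$ be a Metzler matrix that is Hurwitz stable. Let two vectors $\overline{\theta}\in\mathbb{R}^n$, $\overline{\theta}\succeq 0$, and $\delta=[\delta_1,\dots,\delta_n]^T\in\mathbb{R}^n$, $\delta\succeq 0$, be given, and let $t_0\ge 0$. Consider the linear positive system $$\dot u(t)=Au(t),\quad t\ge t_0,\qquad u(t_0)=\theta,$$ where the initial value $\theta$ is unknown but satisfies $0\preceq\theta\preceq\overline{\theta}$, and let $u(t,t_0,\theta)$ be its solution. Then all trajectories of this system converge componentwise within the ball $\mathbb{B}(0,\delta)$ after the finite time $T$ defined below, i.e., for every $\theta$ with $0\preceq\theta\preceq\overline{\theta}$, $$u(t,t_0,\theta)\preceq\delta\qquad\text{for all } t\ge t_0+T.$$ Here $T=\max\{T^1,\dots,T^n\}$ with $$T^i=\min_{\alpha\in(0,\alpha_{\max}]}t^i_\alpha,\qquad t^i_\alpha=\begin{cases}0,&\text{if }\gamma_i\le\delta_i,\\[2pt] -\dfrac1\alpha\ln\dfrac{\delta_i}{\gamma_i},&\text{if }\gamma_i>\delta_i,\end{cases}$$ where $\alpha_{\max}$ is the supremum of the scalars $\alpha>0$ such that $s(A^T+\alpha I)<0$, and $\gamma_i=\gamma_i(\alpha)$ is $$\gamma_i=\min\Big\{\frac{a_j}{b^{(i)}_j}:\ 1\le j\le n,\ b^{(i)}_j>0\Big\},\qquad a=-(A+\alpha I)^{-1}\overline{\theta},\qquad b^{(i)}=-(A+\alpha I)^{-1}e_i.$$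
   Context: Vector inequalities are componentwise: $x\preceq y$ means $x_i\le y_i$ for all $i$. A real square matrix is Metzler if all its off-diagonal entries are nonnegative, and Hurwitz stable if all its eigenvalues have negative real part. $s(M)=\max\{\mathrm{Re}\,\lambda:\lambda\in\sigma(M)\}$ is the spectral abscissa. $e_i$ is the $i$-th standard unit vector of $\mathbb{R}^n$. $\mathbb{B}(0,\delta)=\{x\in\mathbb{R}^n: 0\preceq x\preceq\delta\}$ is an orthotope, called a ball. For $\alpha>0$ with $s(A^T+\alpha I)<0$, the number $\gamma_i(\alpha)$ is the infimum, over all vectors $v$ with positive entries and $(A^T+\alpha I)v$ having all entries negative, of $v^T\overline{\theta}/v_i$; writing $v=-(A^T+\alpha I)^{-1}r$ with $r$ having positive entries turns $v^T\overline{\theta}/v_i$ into $\frac{a_1r_1+\cdots+a_nr_n}{b^{(i)}_1r_1+\cdots+b^{(i)}_nr_n}$.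
   Formalization: T is asserted finite only when all δ_i>0 (if δ_i=0<γ_i then ln 0 makes T infinite); γ_i at α_max, where A+αI is singular, is taken as its limit from the left; the minimum over α is read as an infimum. *)

theory Defs
  imports "HOL-Analysis.Analysis"
begin

definition metzler :: "real ^ 'n ^ 'n \<Rightarrow> bool" where
  "metzler A \<longleftrightarrow> (\<forall>i j. i \<noteq> j \<longrightarrow> 0 \<le> A $ i $ j)"

definition spectrum :: "real ^ 'n ^ 'n \<Rightarrow> complex set" where
  "spectrum A = {z. \<exists>v. v \<noteq> 0 \<and> map_matrix complex_of_real A *v v = z *s v}"

definition hurwitz_stable :: "real ^ 'n ^ 'n \<Rightarrow> bool" where
  "hurwitz_stable A \<longleftrightarrow> (\<forall>z \<in> spectrum A. Re z < 0)"

definition spectral_abscissa :: "real ^ 'n ^ 'n \<Rightarrow> real" where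
  "spectral_abscissa A = Max (Re ` spectrum A)"

definition alpha_max :: "real ^ 'n ^ 'n \<Rightarrow> real" where
  "alpha_max A = Sup {\<alpha>. 0 < \<alpha> \<and> spectral_abscissa (transpose A + \<alpha> *\<^sub>R mat 1) < 0}"

definition a_vec :: "real ^ 'n ^ 'n \<Rightarrow> real ^ 'n \<Rightarrow> real \<Rightarrow> real ^ 'n" where
  "a_vec A \<theta>max \<alpha> = - (matrix_inv (A + \<alpha> *\<^sub>R mat 1) *v \<theta>max)"

definition b_vec :: "real ^ 'n ^ 'n \<Rightarrow> 'n \<Rightarrow> real \<Rightarrow> real ^ 'n" where
  "b_vec A i \<alpha> = - (matrix_inv (A + \<alpha> *\<^sub>R mat 1) *v axis i 1)"

definition min_ratio :: "real ^ 'n ^ 'n \<Rightarrow> real ^ 'n \<Rightarrow> 'n \<Rightarrow> real \<Rightarrow> real" where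
  "min_ratio A \<theta>max i \<alpha> =
     Min {a_vec A \<theta>max \<alpha> $ j / b_vec A i \<alpha> $ j | j. 0 < b_vec A i \<alpha> $ j}"

text \<open>
  For a Metzler matrix \<open>A\<close>, the matrix \<open>A + \<alpha>I\<close> is singular at \<open>\<alpha> = alpha_max A\<close>, so that
  \<open>min_ratio\<close> is meaningless there. On the admissible values of \<open>\<alpha>\<close> it is nondecreasing
  (it is an infimum over a set of vectors that shrinks as \<open>\<alpha>\<close> grows), and the value at the
  right endpoint is its limit from the left, which may be \<open>\<infinity>\<close>.
\<close>

definition gamma :: "real ^ 'n ^ 'n \<Rightarrow> real ^ 'n \<Rightarrow> 'n \<Rightarrow> real \<Rightarrow> ereal" where
  "gamma A \<theta>max i \<alpha> =
     (if spectral_abscissa (transpose A + \<alpha> *\<^sub>R mat 1) < 0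
      then ereal (min_ratio A \<theta>max i \<alpha>)
      else Liminf (at_left \<alpha>) (\<lambda>\<beta>. ereal (min_ratio A \<theta>max i \<beta>)))"

text \<open>
  The logarithm with \<open>ln 0 = -\<infinity>\<close>: if \<open>\<delta>\<^sub>i = 0 < \<gamma>\<^sub>i\<close>, the entry time below has to be \<open>\<infinity>\<close>,
  whereas the library convention \<open>ln 0 = 0\<close> on the reals would make it 0.
\<close>

definition ext_ln :: "ereal \<Rightarrow> ereal" where
  "ext_ln x = (if x \<le> 0 then -\<infinity> else if x = \<infinity> then \<infinity> else ereal (ln (real_of_ereal x)))"

definition entry_time_at :: "real ^ 'n ^ 'n \<Rightarrow> real ^ 'n \<Rightarrow> real ^ 'n \<Rightarrow> 'n \<Rightarrow> real \<Rightarrow> ereal" where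
  "entry_time_at A \<theta>max \<delta> i \<alpha> =
     (if gamma A \<theta>max i \<alpha> \<le> ereal (\<delta> $ i) then 0
      else - ereal (1 / \<alpha>) * ext_ln (ereal (\<delta> $ i) / gamma A \<theta>max i \<alpha>))"

text \<open>
  The infimum is the minimum whenever that exists; it may fail to be attained, being approached only as \<open>\<alpha> \<rightarrow> 0\<close>.
\<close>

definition entry_time_comp :: "real ^ 'n ^ 'n \<Rightarrow> real ^ 'n \<Rightarrow> real ^ 'n \<Rightarrow> 'n \<Rightarrow> ereal" where
  "entry_time_comp A \<theta>max \<delta> i = (INF \<alpha> \<in> {0<..alpha_max A}. entry_time_at A \<theta>max \<delta> i \<alpha>)"

definition entry_time :: "real ^ 'n ^ 'n \<Rightarrow> real ^ 'n \<Rightarrow> real ^ 'n \<Rightarrow> ereal" where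
  "entry_time A \<theta>max \<delta> = Max (range (entry_time_comp A \<theta>max \<delta>))"

end

theory Submission
  imports Defs "HOL-Computational_Algebra.Fundamental_Theorem_Algebra"
begin

text \<open>
  For \<open>0 < \<alpha> < alpha_max A = - spectral_abscissa A\<close> the matrix \<open>W = -(A + \<alpha> I)\<inverse>\<close> is entrywise nonnegative,
  so each row \<open>f\<close> of \<open>W\<close> decays like \<open>e\<^sup>-\<^sup>\<alpha>\<^sup>t\<close> along nonnegative trajectories. As \<open>b\<^sub>j u\<^sub>i \<le> f(u)\<close> and
  initially \<open>f(u) \<le> a\<^sub>j\<close>, this gives \<open>u\<^sub>i(t) \<le> \<gamma>\<^sub>i(\<alpha>) e\<^sup>-\<^sup>\<alpha>\<^sup>(\<^sup>t\<^sup>-\<^sup>t\<^sup>0\<^sup>)\<close>, which passes to \<open>\<alpha> = alpha_max A\<close> in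
  the limit from the left. The infimum over \<open>\<alpha>\<close> need not be attained, so one first bounds \<open>u\<^sub>i\<close> at times
  \<open>s > t\<close> and then lets \<open>s \<rightarrow> t\<close>.
\<close>

section \<open>Spectrum and spectral abscissa\<close>

lemma mat_mult_vec: "mat z *v v = z *s v"
  by (simp add: vec_eq_iff matrix_vector_mult_def mat_def if_distrib[of "\<lambda>x. x * _"] cong: if_cong)

text \<open>Stated over any field, since it serves complex eigenvalues and, for the invertibility of
  shifts, real ones.\<close>

lemma ex_eigenvector_iff_det:
  fixes B :: "'a::field^'n^'n"
  shows "(\<exists>v. v \<noteq> 0 \<and> B *v v = z *s v) \<longleftrightarrow> det (B - mat z) = 0"
proof -
  have "det (B - mat z) = 0 \<longleftrightarrow> \<not> (\<forall>x. (B - mat z) *v x = 0 \<longrightarrow> x = 0)"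
    by (metis invertible_det_nz invertible_left_inverse matrix_left_invertible_ker)
  then show ?thesis
    by (auto simp: matrix_vector_mult_diff_rdistrib mat_mult_vec)
qed

lemma mem_spectrum_iff_det:
  "z \<in> spectrum A \<longleftrightarrow> det (map_matrix complex_of_real A - mat z) = 0"
  by (simp add: spectrum_def ex_eigenvector_iff_det)

text \<open>The Leibniz formula can be read over the polynomial ring, and evaluation commutes with
  its sums and products.\<close>

lemma det_pencil_poly:
  fixes X Y :: "'a::comm_ring_1^'n^'n"
  obtains p where "\<And>z. poly p z = det (\<chi> i j. X $ i $ j + z * Y $ i $ j)"
proof
  show "poly (det (\<chi> i j. [:X $ i $ j, Y $ i $ j:])) z = det (\<chi> i j. X $ i $ j + z * Y $ i $ j)" for z
    by (simp add: det_def poly_sum poly_prod)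
qed

text \<open>
  If the characteristic polynomial were a constant \<open>c\<close>, then \<open>det (w B - I) = c w\<^sup>n\<close> for \<open>w \<noteq> 0\<close>,
  hence for \<open>w = 0\<close>, contradicting \<open>det (- I) \<noteq> 0\<close>.
\<close>

lemma charpoly_not_constant:
  fixes B :: "complex^'n^'n"
  obtains p where "\<And>z. poly p z = det (B - mat z)" "\<not> constant (poly p)"
proof -
  obtain p where "\<And>z. poly p z = det (\<chi> i j. B $ i $ j + z * (- mat 1) $ i $ j)"
    using det_pencil_poly[of B "- mat 1"] by blast
  moreover have "(\<chi> i j. B $ i $ j + z * (- mat 1) $ i $ j) = B - mat z" for z
    by (simp add: vec_eq_iff mat_def)
  ultimately have p: "poly p z = det (B - mat z)" for z
    by simp
  obtain q where "\<And>w. poly q w = det (\<chi> i j. (- mat 1) $ i $ j + w * B $ i $ j)"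
    using det_pencil_poly[of "- mat 1" B] by blast
  moreover have "(\<chi> i j. (- mat 1) $ i $ j + w * B $ i $ j) = (\<chi> i. w *s B $ i) - mat 1" for w
    by (simp add: vec_eq_iff)
  ultimately have q: "poly q w = det ((\<chi> i. w *s B $ i) - mat 1)" for w
    by simp
  have "\<not> constant (poly p)"
  proof
    assume "constant (poly p)"
    then obtain c where c: "poly p z = c" for z
      by (metis constant_def)
    have qw: "poly q w = poly (monom c CARD('n)) w" if "w \<noteq> 0" for w
    proof -
      have "(\<chi> i. w *s B $ i) - mat 1 = (\<chi> i. w *s (B - mat (1 / w)) $ i)"
        using that by (simp add: vec_eq_iff mat_def right_diff_distrib)
      also have "det \<dots> = w ^ CARD('n) * det (\<chi> i. (B - mat (1 / w)) $ i)"
        by (subst det_rows_mul) simp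
      also have "det (\<chi> i. (B - mat (1 / w)) $ i) = c"
        by (simp only: vec_lambda_eta p[symmetric] c)
      finally show ?thesis
        by (simp add: q poly_monom)
    qed
    have "UNIV - {0} \<subseteq> {w. poly (q - monom c CARD('n)) w = 0}"
      using qw by auto
    moreover have "infinite (UNIV - {0::complex})"
      by (simp add: infinite_UNIV_char_0)
    ultimately have "q - monom c CARD('n) = 0"
      using poly_roots_finite finite_subset by blast
    \<comment> \<open>\<open>CARD('n)\<close> is positive, so the monomial vanishes at 0.\<close>
    then have "poly q 0 = 0"
      by (simp add: poly_monom)
    moreover have "(\<chi> i. 0 *s B $ i) - mat 1 = (\<chi> i. (- 1) *s (mat 1 :: complex^'n^'n) $ i)"
      by (simp add: vec_eq_iff)
    then have "poly q 0 = (- 1) ^ CARD('n)"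
      unfolding q by (simp only: det_rows_mul) simp
    ultimately show False
      by simp
  qed
  with p that show ?thesis
    by blast
qed

text \<open>The spectrum is the zero set of a nonconstant polynomial. Both facts give
  \<open>Max\<close> in \<open>spectral_abscissa\<close> its meaning.\<close>

lemma finite_spectrum: "finite (spectrum A)"
  and spectrum_nonempty: "spectrum A \<noteq> {}"
proof -
  obtain p where p: "\<And>z. poly p z = det (map_matrix complex_of_real A - mat z)"
      and nc: "\<not> constant (poly p)"
    using charpoly_not_constant by blast
  have eq: "spectrum A = {z. poly p z = 0}"
    by (auto simp: p mem_spectrum_iff_det)
  have "p \<noteq> 0"
    using nc by (auto simp: constant_def)
  then show "finite (spectrum A)"
    by (simp add: eq poly_roots_finite)
  show "spectrum A \<noteq> {}"
    using fundamental_theorem_of_algebra[OF nc] by (simp add: eq)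
qed

section \<open>Transposition and shifts\<close>

lemma spectrum_transpose: "spectrum (transpose A) = spectrum A"
proof -
  have "map_matrix complex_of_real (transpose A) - mat z
      = transpose (map_matrix complex_of_real A - mat z)" for z
    by (simp add: vec_eq_iff transpose_def mat_def)
  then show ?thesis
    by (auto simp: mem_spectrum_iff_det)
qed

lemma spectrum_add_scaleR_mat:
  "spectrum (A + \<alpha> *\<^sub>R mat 1) = (\<lambda>z. z + complex_of_real \<alpha>) ` spectrum A"
proof -
  have "map_matrix complex_of_real (A + \<alpha> *\<^sub>R mat 1) - mat z
      = map_matrix complex_of_real A - mat (z - complex_of_real \<alpha>)" for z
    by (simp add: vec_eq_iff mat_def)
  then have "z \<in> spectrum (A + \<alpha> *\<^sub>R mat 1) \<longleftrightarrow> z - complex_of_real \<alpha> \<in> spectrum A" for z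
    by (simp add: mem_spectrum_iff_det)
  then show ?thesis
    by (force simp: image_iff)
qed

lemma spectral_abscissa_shift:
  "spectral_abscissa (transpose A + \<alpha> *\<^sub>R mat 1) = spectral_abscissa A + \<alpha>"
  using Max_add_commute[OF finite_spectrum spectrum_nonempty, of Re \<alpha> A]
  by (simp add: spectral_abscissa_def spectrum_add_scaleR_mat spectrum_transpose image_image)

lemma hurwitz_stable_iff_spectral_abscissa: "hurwitz_stable A \<longleftrightarrow> spectral_abscissa A < 0"
  by (simp add: hurwitz_stable_def spectral_abscissa_def Max_less_iff finite_spectrum spectrum_nonempty)

lemma hurwitz_stable_shift_iff:
  "hurwitz_stable (A + \<alpha> *\<^sub>R mat 1) \<longleftrightarrow> spectral_abscissa (transpose A + \<alpha> *\<^sub>R mat 1) < 0"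
  by (simp add: hurwitz_stable_def spectral_abscissa_def Max_less_iff finite_spectrum
      spectrum_nonempty spectrum_add_scaleR_mat spectrum_transpose)

text \<open>By the shift formula the admissible \<alpha> form the open interval from 0 to
  \<open>- spectral_abscissa A\<close>, nonempty by stability; its right endpoint is not
  admissible.\<close>

lemma alpha_max_eq:
  assumes "hurwitz_stable A"
  shows "alpha_max A = - spectral_abscissa A"
proof -
  have "{\<alpha>. 0 < \<alpha> \<and> spectral_abscissa (transpose A + \<alpha> *\<^sub>R mat 1) < 0} = {0<..<- spectral_abscissa A}"
    by (auto simp: spectral_abscissa_shift)
  then show ?thesis
    using assms by (simp add: alpha_max_def hurwitz_stable_iff_spectral_abscissa)
qed

section \<open>Metzler matrices\<close>

lemma metzler_shift: "metzler A \<Longrightarrow> metzler (A + \<alpha> *\<^sub>R mat 1)"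
  by (simp add: metzler_def mat_def)

text \<open>The diagonal entry, the only one in row \<open>i\<close> that may be negative, is
  multiplied by 0.\<close>

lemma metzler_mult_nonneg_at_zero:
  assumes "metzler M" "\<And>k. 0 \<le> y $ k" "y $ i = 0"
  shows "0 \<le> (M *v y) $ i"
proof -
  have "0 \<le> M $ i $ j * y $ j" for j
    using assms by (cases "i = j") (auto simp: metzler_def)
  then show ?thesis
    by (simp add: matrix_vector_mult_def sum_nonneg)
qed

text \<open>Minimum principle: with \<open>m\<close> the least ratio \<open>x $ i / v $ i\<close>,
  the vector \<open>x - m v\<close> is nonnegative and vanishes at a minimizer \<open>i\<close>. If
  \<open>m < 0\<close>, row \<open>i\<close> of \<open>M (x - m v)\<close> would be
  negative.\<close>

lemma metzler_monotone:
  fixes x :: "real^'n"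
  assumes M: "metzler M" and v: "\<And>i. 0 < v $ i" and Mv: "\<And>i. (M *v v) $ i < 0"
    and Mx: "\<And>i. (M *v x) $ i \<le> 0"
  shows "0 \<le> x $ k"
proof (rule ccontr)
  assume neg: "\<not> 0 \<le> x $ k"
  define m where "m = Min (range (\<lambda>i. x $ i / v $ i))"
  have "m \<in> range (\<lambda>i. x $ i / v $ i)"
    unfolding m_def by (intro Min_in) auto
  then obtain i where i: "m = x $ i / v $ i"
    by blast
  have le: "m \<le> x $ j / v $ j" for j
    unfolding m_def by (intro Min_le) auto
  have "x $ k / v $ k < 0"
    using neg v[of k] by (simp add: divide_neg_pos)
  then have "m < 0"
    using le[of k] by linarith
  define y where "y = x - m *\<^sub>R v"
  have "0 \<le> y $ j" for j
    using le[of j] v[of j] by (simp add: y_def pos_le_divide_eq)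
  moreover have "y $ i = 0"
    using i v[of i] by (simp add: y_def)
  ultimately have "0 \<le> (M *v y) $ i"
    using M metzler_mult_nonneg_at_zero by blast
  then have "m * (M *v v) $ i \<le> 0"
    using Mx[of i] by (simp add: y_def matrix_vector_mult_diff_distrib matrix_vector_mult_scaleR)
  with \<open>m < 0\<close> Mv[of i] show False
    by (simp add: mult_le_0_iff)
qed

text \<open>
  The set of \<open>\<lambda>\<close> admitting a positive \<open>v\<close> with \<open>M v < \<lambda> v\<close> is an open up-set. At its infimum \<open>L\<close>,
  if \<open>M - L I\<close> is invertible, the solution of \<open>(M - L I) v = -1\<close> is positive, so \<open>L\<close> lies in the set,
  which is absurd; hence the infimum is negative.
\<close>

lemma metzler_ex_positive_vector:
  fixes M :: "real^'n^'n"
  assumes M: "metzler M" and inv: "\<And>l. 0 \<le> l \<Longrightarrow> invertible (M - l *\<^sub>R mat 1)"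
  obtains v where "\<And>i. 0 < v $ i" "\<And>i. (M *v v) $ i < 0"
proof -
  define S where "S = {l. \<exists>v. (\<forall>i. 0 < v $ i) \<and> (\<forall>i. (M *v v) $ i < l * v $ i)}"
  have up: "l' \<in> S" if "l \<in> S" "l \<le> l'" for l l'
  proof -
    obtain v where v: "\<forall>i. 0 < v $ i" "\<forall>i. (M *v v) $ i < l * v $ i"
      using \<open>l \<in> S\<close> by (auto simp: S_def)
    moreover have "l * v $ i \<le> l' * v $ i" for i
      using v(1) \<open>l \<le> l'\<close> by (simp add: mult_right_mono less_imp_le)
    ultimately show ?thesis
      unfolding S_def using less_le_trans by blast
  qed
  have "0 \<in> S"
  proof (rule ccontr)
    assume "0 \<notin> S"
    then have pos: "0 \<le> l" if "l \<in> S" for l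
      using up[of l 0] that by force
    define L where "L = Inf S"
    \<comment> \<open>For the all-ones vector, \<open>M v\<close> lists the row sums, so
      \<open>S\<close> contains any number above the largest of them.\<close>
    have "(M *v 1) $ i \<le> Max (range (\<lambda>i. (M *v 1) $ i))" for i
      by (intro Max_ge) auto
    then have "(M *v 1) $ i < Max (range (\<lambda>i. (M *v 1) $ i)) + 1" for i
      by (simp add: le_less_trans[OF _ less_add_one])
    then have "Max (range (\<lambda>i. (M *v 1) $ i)) + 1 \<in> S"
      unfolding S_def by (auto intro!: exI[of _ 1])
    then have "S \<noteq> {}"
      by blast
    then have "0 \<le> L"
      unfolding L_def using pos by (intro cInf_greatest)
    have bdd: "bdd_below S"
      using pos by (auto simp: bdd_below_def)
    have above: "l \<in> S" if "L < l" for l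
      using that cInf_lessD[OF \<open>S \<noteq> {}\<close>, of l] up by (force simp: L_def)
    obtain N where "(M - L *\<^sub>R mat 1) ** N = mat 1"
      using inv[OF \<open>0 \<le> L\<close>] by (auto simp: invertible_def)
    then have "(M - L *\<^sub>R mat 1) *v (N *v (- 1)) = - 1"
      by (simp add: matrix_vector_mul_assoc)
    then obtain v where "(M - L *\<^sub>R mat 1) *v v = - 1"
      by blast
    then have v: "(M *v v) $ i = L * v $ i - 1" for i
      by (simp add: vec_eq_iff matrix_vector_mult_diff_rdistrib scaleR_matrix_vector_assoc[symmetric] algebra_simps)
    \<comment> \<open>This \<open>e\<close> keeps \<open>e v\<close> below 1 in absolute value in
      every component, so the slack 1 in \<open>M v = L v - 1\<close> absorbs a shift of
      \<open>L\<close> by \<open>e\<close> in either direction.\<close>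
    define e where "e = 1 / (1 + norm v)"
    have "0 < e"
      by (simp add: e_def add_pos_nonneg)
    have small: "\<bar>e * v $ i\<bar> < 1" for i
      using component_le_norm_cart[of v i]
      by (simp add: e_def abs_mult add_pos_nonneg divide_less_eq abs_divide)
    obtain w where w: "\<And>i. 0 < w $ i" "\<And>i. (M *v w) $ i < (L + e) * w $ i"
      using above[of "L + e"] \<open>0 < e\<close> by (auto simp: S_def)
    \<comment> \<open>A positive comparison vector is known only above \<open>L\<close>, hence the
      comparison at \<open>L + e\<close>.\<close>
    have nonneg: "0 \<le> v $ i" for i
    proof (rule metzler_monotone[of "M + (- (L + e)) *\<^sub>R mat 1" w])
      show "metzler (M + (- (L + e)) *\<^sub>R mat 1)"
        using M by (rule metzler_shift)
      show "((M + (- (L + e)) *\<^sub>R mat 1) *v w) $ i < 0" for i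
        using w(2)[of i]
        by (simp add: matrix_vector_mult_add_rdistrib scaleR_matrix_vector_assoc[symmetric] algebra_simps)
      show "((M + (- (L + e)) *\<^sub>R mat 1) *v v) $ i \<le> 0" for i
        using small[of i] v[of i]
        by (simp add: matrix_vector_mult_add_rdistrib scaleR_matrix_vector_assoc[symmetric] algebra_simps abs_if split: if_splits)
    qed (use w in auto)
    \<comment> \<open>At a zero of \<open>v\<close>, the entry of \<open>M v\<close> would be both
      nonnegative and equal to -1.\<close>
    have "v $ i \<noteq> 0" for i
      using metzler_mult_nonneg_at_zero[OF M nonneg, of i] v[of i] by auto
    then have "0 < v $ i" for i
      using nonneg[of i] by (simp add: less_le)
    moreover have "(M *v v) $ i < (L - e) * v $ i" for i
      using small[of i] v[of i] by (simp add: algebra_simps)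
    ultimately have "L - e \<in> S"
      by (auto simp: S_def)
    then have "L \<le> L - e"
      unfolding L_def using bdd by (rule cInf_lower)
    with \<open>0 < e\<close> show False
      by simp
  qed
  with that show ?thesis
    by (auto simp: S_def)
qed

text \<open>A real kernel vector, read as a complex one, would be an eigenvector for
  \<open>l \<ge> 0\<close>, against stability.\<close>

lemma hurwitz_stable_invertible_shift:
  assumes "hurwitz_stable M" "0 \<le> l"
  shows "invertible (M - l *\<^sub>R mat 1)"
proof (rule ccontr)
  assume "\<not> invertible (M - l *\<^sub>R mat 1)"
  moreover have "M - l *\<^sub>R mat 1 = M - mat l"
    by (simp add: vec_eq_iff mat_def)
  ultimately have "det (M - mat l) = 0"
    by (simp add: invertible_det_nz)
  then obtain x where x: "x \<noteq> 0" "M *v x = l *s x"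
    using ex_eigenvector_iff_det by blast
  define v where "v = (\<chi> i. complex_of_real (x $ i))"
  have "v \<noteq> 0"
    using \<open>x \<noteq> 0\<close> by (simp add: v_def vec_eq_iff)
  moreover have "(map_matrix complex_of_real M *v v) $ i = complex_of_real ((M *v x) $ i)" for i
    by (simp add: v_def matrix_vector_mult_def)
  then have "map_matrix complex_of_real M *v v = complex_of_real l *s v"
    by (simp add: vec_eq_iff x(2)) (simp add: v_def)
  ultimately have "complex_of_real l \<in> spectrum M"
    by (auto simp: spectrum_def)
  with assms show False
    by (force simp: hurwitz_stable_def)
qed

section \<open>Sign of the inverse\<close>

lemma matrix_inv_cancel:
  assumes "invertible M"
  shows "M ** matrix_inv M = mat 1" "matrix_inv M ** M = mat 1"
  using someI_ex[OF assms[unfolded invertible_def]] by (simp_all add: matrix_inv_def)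

lemma hurwitz_stable_invertible:
  assumes "hurwitz_stable M"
  shows "invertible M"
  using hurwitz_stable_invertible_shift[OF assms order_refl] by simp

text \<open>Column \<open>i\<close> of \<open>- matrix_inv M\<close> solves
  \<open>M x = - axis i 1\<close>, so the minimum principle makes it nonnegative.\<close>

lemma metzler_hurwitz_inverse_nonpos:
  assumes "metzler M" "hurwitz_stable M"
  shows "matrix_inv M $ j $ i \<le> 0"
proof -
  obtain v where v: "\<And>i. 0 < v $ i" "\<And>i. (M *v v) $ i < 0"
    using metzler_ex_positive_vector[OF assms(1) hurwitz_stable_invertible_shift[OF assms(2)]] by blast
  define x where "x = - (matrix_inv M *v axis i 1)"
  have "M *v x = - axis i 1"
    unfolding x_def
    by (simp add: linear_neg[OF matrix_vector_mul_linear] matrix_vector_mul_assoc matrix_inv_cancel hurwitz_stable_invertible assms)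
  then have "0 \<le> x $ j"
    using v assms(1) by (intro metzler_monotone[of M v x]) (auto simp: axis_def)
  then show ?thesis
    by (simp add: x_def matrix_vector_mult_basis column_def)
qed

section \<open>Trajectories\<close>

text \<open>Squaring smooths the kink of the negative part: at 0 the difference quotient is at most
  \<open>\<bar>y\<bar>\<close> in size.\<close>

lemma DERIV_min_0_squared: "((\<lambda>x::real. (min x 0)\<^sup>2) has_real_derivative 2 * min x 0) (at x)"
proof -
  have pos: "((\<lambda>x::real. (min x 0)\<^sup>2) has_real_derivative 2 * min x 0) (at x)" if "0 < x" for x
  proof (rule DERIV_cong_ev[THEN iffD2])
    show "\<forall>\<^sub>F y in nhds x. (min y 0)\<^sup>2 = 0"
      using eventually_nhds_in_open[of "{0<..}" x] that by (auto elim!: eventually_mono)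
    show "((\<lambda>x. 0) has_real_derivative 0) (at x)"
      by simp
  qed (use that in auto)
  have neg: "((\<lambda>x::real. (min x 0)\<^sup>2) has_real_derivative 2 * min x 0) (at x)" if "x < 0" for x
  proof (rule DERIV_cong_ev[THEN iffD2])
    show "\<forall>\<^sub>F y in nhds x. (min y 0)\<^sup>2 = y\<^sup>2"
      using eventually_nhds_in_open[of "{..<0}" x] that by (auto elim!: eventually_mono)
    show "((\<lambda>x. x\<^sup>2) has_real_derivative 2 * x) (at x)"
      by (auto intro!: derivative_eq_intros)
  qed (use that in auto)
  have zero: "((\<lambda>x::real. (min x 0)\<^sup>2) has_real_derivative 0) (at 0)"
    unfolding has_field_derivative_iff
  proof (rule Lim_null_comparison)
    show "\<forall>\<^sub>F y in at 0. norm (((min y 0)\<^sup>2 - (min 0 0)\<^sup>2) / (y - 0)) \<le> \<bar>y\<bar>"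
      by (rule always_eventually) (auto simp: min_def power2_eq_square)
    show "((\<lambda>y::real. \<bar>y\<bar>) \<longlongrightarrow> 0) (at 0)"
      by (intro tendsto_rabs_zero tendsto_ident_at)
  qed
  show ?thesis
    using pos[of x] neg[of x] zero by (cases x "0::real" rule: linorder_cases) auto
qed

text \<open>Gronwall by the integrating factor \<open>exp (c * (s - t0))\<close>, with
  \<open>c\<close> of either sign. The derivative is taken in the open interval because trajectories
  have only a one-sided one at \<open>t0\<close>.\<close>

lemma exp_weighted_decreasing:
  fixes f :: "real \<Rightarrow> real"
  assumes "t0 \<le> t" and cont: "continuous_on {t0..t} f"
    and deriv: "\<And>s. t0 < s \<Longrightarrow> s < t \<Longrightarrow> \<exists>d. (f has_real_derivative d) (at s) \<and> d \<le> - c * f s"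
  shows "f t * exp (c * (t - t0)) \<le> f t0"
proof -
  have "f t * exp (c * (t - t0)) \<le> f t0 * exp (c * (t0 - t0))"
  proof (rule DERIV_nonpos_imp_decreasing_open[OF \<open>t0 \<le> t\<close>])
    fix s assume s: "t0 < s" "s < t"
    then obtain d where d: "(f has_real_derivative d) (at s)" "d \<le> - c * f s"
      using deriv by blast
    have "((\<lambda>s. f s * exp (c * (s - t0))) has_real_derivative (d + c * f s) * exp (c * (s - t0))) (at s)"
      using d(1) by (auto intro!: derivative_eq_intros simp: algebra_simps)
    moreover have "(d + c * f s) * exp (c * (s - t0)) \<le> 0"
      using d(2) by (simp add: mult_le_0_iff)
    ultimately show "\<exists>y. ((\<lambda>s. f s * exp (c * (s - t0))) has_real_derivative y) (at s) \<and> y \<le> 0"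
      by blast
  qed (intro continuous_intros cont)
  then show ?thesis
    by simp
qed

locale positive_trajectory =
  fixes A :: "real^'n^'n" and u :: "real \<Rightarrow> real^'n" and t0 :: real
  assumes metzler: "metzler A"
    and initial_nonneg: "0 \<le> u t0"
    and ode: "\<And>t. t0 \<le> t \<Longrightarrow> (u has_vector_derivative A *v u t) (at t within {t0..})"
begin

lemma continuous_on_u: "continuous_on {t0..} u"
  using ode by (auto simp: continuous_on_eq_continuous_within intro: has_vector_derivative_continuous)

lemma DERIV_component:
  assumes "t0 < t"
  shows "((\<lambda>s. u s $ i) has_real_derivative (A *v u t) $ i) (at t)"
proof -
  have "(u has_vector_derivative A *v u t) (at t)"
    using ode[of t] assms by (simp add: at_within_open_subset[of t "{t0<..}" "{t0..}"] subset_eq)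
  then show ?thesis
    by (simp add: bounded_linear.has_vector_derivative[OF bounded_linear_vec_nth]
        has_real_derivative_iff_has_vector_derivative)
qed

text \<open>
  For \<open>\<phi> = \<Sum>\<^sub>i min(u\<^sub>i, 0)\<^sup>2\<close> the signs of the off-diagonal entries give \<open>\<phi>' \<le> K \<phi>\<close>, and \<open>\<phi>(t0) = 0\<close>.
\<close>

lemma nonneg:
  assumes "t0 \<le> t"
  shows "0 \<le> u t $ i"
proof -
  define \<phi> where "\<phi> s = (\<Sum>i\<in>UNIV. (min (u s $ i) 0)\<^sup>2)" for s
  \<comment> \<open>Each pair \<open>i\<close>, \<open>j\<close> contributes at most
    \<open>2 * \<bar>A $ i $ j\<bar> * \<phi> s\<close> to the derivative, by
    \<open>2ab \<le> a^2 + b^2\<close>.\<close>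
  define K where "K = 2 * (\<Sum>i\<in>UNIV. \<Sum>j\<in>UNIV. \<bar>A $ i $ j\<bar>)"
  have "\<phi> t * exp (- K * (t - t0)) \<le> \<phi> t0"
  proof (rule exp_weighted_decreasing[OF assms])
    show "continuous_on {t0..t} \<phi>"
      unfolding \<phi>_def
      by (intro continuous_intros continuous_on_subset[OF continuous_on_u]) auto
    fix s assume "t0 < s"
    let ?m = "\<lambda>i. min (u s $ i) 0"
    have "(\<phi> has_real_derivative (\<Sum>i\<in>UNIV. 2 * ?m i * (A *v u s) $ i)) (at s)"
      unfolding \<phi>_def
      by (intro DERIV_sum DERIV_chain2[OF DERIV_min_0_squared] DERIV_component \<open>t0 < s\<close>)
    moreover have "(\<Sum>i\<in>UNIV. 2 * ?m i * (A *v u s) $ i) \<le> K * \<phi> s"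
    proof -
      have term_le: "2 * ?m i * (A $ i $ j * u s $ j) \<le> 2 * \<bar>A $ i $ j\<bar> * \<phi> s" for i j
      proof -
        \<comment> \<open>Off the diagonal \<open>?m i \<le> 0 \<le> A $ i $ j\<close>, so lowering
          \<open>u s $ j\<close> to \<open>?m j\<close> cannot decrease the product; on the diagonal
          both sides agree.\<close>
        have "?m i * (A $ i $ j * u s $ j) \<le> ?m i * (A $ i $ j * ?m j)"
        proof (cases "i = j")
          case False
          then have "0 \<le> A $ i $ j"
            using metzler by (simp add: metzler_def)
          then show ?thesis
            by (intro mult_left_mono_neg mult_left_mono) auto
        qed (auto simp: min_def)
        also have "2 * \<dots> = A $ i $ j * (2 * ?m i * ?m j)"
          by simp
        also have "\<dots> \<le> \<bar>A $ i $ j\<bar> * \<bar>2 * ?m i * ?m j\<bar>"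
          by (metis abs_ge_self abs_mult)
        also have "\<dots> \<le> \<bar>A $ i $ j\<bar> * ((?m i)\<^sup>2 + (?m j)\<^sup>2)"
          using sum_squares_bound[of "\<bar>?m i\<bar>" "\<bar>?m j\<bar>"]
          by (intro mult_left_mono) (auto simp: abs_mult)
        also have "\<dots> \<le> \<bar>A $ i $ j\<bar> * (\<phi> s + \<phi> s)"
          unfolding \<phi>_def by (intro mult_left_mono add_mono member_le_sum) auto
        finally show ?thesis
          by simp
      qed
      have "(\<Sum>i\<in>UNIV. 2 * ?m i * (A *v u s) $ i)
          = (\<Sum>i\<in>UNIV. \<Sum>j\<in>UNIV. 2 * ?m i * (A $ i $ j * u s $ j))"
        by (simp add: matrix_vector_mult_def sum_distrib_left)
      also have "\<dots> \<le> (\<Sum>i\<in>UNIV. \<Sum>j\<in>UNIV. 2 * \<bar>A $ i $ j\<bar> * \<phi> s)"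
        by (intro sum_mono term_le)
      also have "\<dots> = K * \<phi> s"
        by (simp add: K_def sum_distrib_left sum_distrib_right)
      finally show ?thesis .
    qed
    ultimately show "\<exists>d. (\<phi> has_real_derivative d) (at s) \<and> d \<le> - (- K) * \<phi> s"
      by auto
  qed
  moreover have "\<phi> t0 = 0"
    using initial_nonneg by (simp add: \<phi>_def less_eq_vec_def)
  ultimately have "\<phi> t \<le> 0"
    by (simp add: mult_le_0_iff)
  moreover have "(min (u t $ i) 0)\<^sup>2 \<le> \<phi> t"
    unfolding \<phi>_def by (intro member_le_sum) auto
  ultimately have "min (u t $ i) 0 = 0"
    by (metis order_trans power2_less_eq_zero_iff)
  then show ?thesis
    by (simp add: min_def split: if_splits)
qed

text \<open>
  Row \<open>j\<close> of \<open>-(A + \<alpha> I)\<inverse>\<close> is a linear functional \<open>f \<ge> 0\<close> with \<open>f' = - \<alpha> f - u\<^sub>j \<le> - \<alpha> f\<close> along the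
  trajectory.
\<close>

lemma component_le_min_ratio:
  assumes "u t0 \<le> \<theta>max" "t0 \<le> t" and hurwitz: "hurwitz_stable (A + \<alpha> *\<^sub>R mat 1)"
  shows "u t $ i * exp (\<alpha> * (t - t0)) \<le> min_ratio A \<theta>max i \<alpha>"
proof -
  define M where "M = A + \<alpha> *\<^sub>R mat 1"
  define W where "W = - matrix_inv M"
  have W: "0 \<le> W $ j $ k" for j k
    using metzler_hurwitz_inverse_nonpos[of M j k] metzler hurwitz
    by (simp add: W_def M_def metzler_shift)
  have minus_vec: "W *v x = - (matrix_inv M *v x)" for x
    by (simp add: W_def matrix_vector_mult_def vec_eq_iff sum_negf)
  have a: "a_vec A \<theta>max \<alpha> = W *v \<theta>max" and b: "b_vec A i \<alpha> $ j = W $ j $ i" for j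
    by (simp_all add: a_vec_def b_vec_def minus_vec M_def[symmetric])
      (simp add: W_def matrix_vector_mult_basis column_def)
  have WM: "W *v (M *v x) = - x" for x
    using matrix_inv_cancel(2)[of M] hurwitz
    unfolding minus_vec by (simp add: matrix_vector_mul_assoc hurwitz_stable_invertible M_def)
  have mono: "(W *v x) $ j \<le> (W *v y) $ j" if "\<And>k. x $ k \<le> y $ k" for x y j
    using that W by (simp add: matrix_vector_mult_def sum_mono mult_left_mono)
  have bound: "u t $ i * exp (\<alpha> * (t - t0)) \<le> a_vec A \<theta>max \<alpha> $ j / b_vec A i \<alpha> $ j"
    if "0 < b_vec A i \<alpha> $ j" for j
  proof -
    define f where "f s = (W *v u s) $ j" for s
    have "f t * exp (\<alpha> * (t - t0)) \<le> f t0"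
    proof (rule exp_weighted_decreasing[OF \<open>t0 \<le> t\<close>])
      show "continuous_on {t0..t} f"
        unfolding f_def matrix_vector_mult_def
        by (auto intro!: continuous_intros continuous_on_subset[OF continuous_on_u])
      fix s assume "t0 < s"
      have "(f has_real_derivative (\<Sum>k\<in>UNIV. W $ j $ k * (A *v u s) $ k)) (at s)"
        unfolding f_def matrix_vector_mult_def vec_lambda_beta
        by (intro DERIV_sum DERIV_cmult)
          (use DERIV_component[OF \<open>t0 < s\<close>] in \<open>simp add: matrix_vector_mult_def\<close>)
      moreover have "(\<Sum>k\<in>UNIV. W $ j $ k * (A *v u s) $ k) = (W *v (A *v u s)) $ j"
        by (simp add: matrix_vector_mult_def)
      moreover have "A *v u s = M *v u s - \<alpha> *\<^sub>R u s"
        by (simp add: M_def matrix_vector_mult_add_rdistrib scaleR_matrix_vector_assoc[symmetric])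
      then have "(W *v (A *v u s)) $ j = - u s $ j - \<alpha> * f s"
        by (simp add: matrix_vector_mult_diff_distrib matrix_vector_mult_scaleR WM f_def)
      moreover have "0 \<le> u s $ j"
        using nonneg \<open>t0 < s\<close> by simp
      ultimately show "\<exists>d. (f has_real_derivative d) (at s) \<and> d \<le> - \<alpha> * f s"
        by auto
    qed
    moreover have "f t0 \<le> a_vec A \<theta>max \<alpha> $ j"
      unfolding f_def a using \<open>u t0 \<le> \<theta>max\<close> by (intro mono) (simp add: less_eq_vec_def)
    moreover have "W $ j $ i * u t $ i \<le> f t"
      unfolding f_def matrix_vector_mult_def vec_lambda_beta
      using nonneg[OF \<open>t0 \<le> t\<close>] W by (intro member_le_sum[of i UNIV "\<lambda>k. W $ j $ k * u t $ k"]) auto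
    then have "W $ j $ i * u t $ i * exp (\<alpha> * (t - t0)) \<le> f t * exp (\<alpha> * (t - t0))"
      by (intro mult_right_mono) auto
    ultimately have "W $ j $ i * u t $ i * exp (\<alpha> * (t - t0)) \<le> a_vec A \<theta>max \<alpha> $ j"
      by linarith
    then show ?thesis
      using that by (simp add: b pos_le_divide_eq mult_ac)
  qed
  \<comment> \<open>\<open>Min\<close> needs a nonempty set: column \<open>i\<close> of an
    invertible matrix cannot vanish.\<close>
  have "\<exists>j. 0 < b_vec A i \<alpha> $ j"
  proof (rule ccontr)
    assume "\<nexists>j. 0 < b_vec A i \<alpha> $ j"
    then have "W $ j $ i = 0" for j
      using W[of j i] by (auto simp: b not_less intro: antisym)
    then have "matrix_inv M *v axis i 1 = 0"
      by (simp add: W_def matrix_vector_mult_basis column_def vec_eq_iff)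
    then have "M *v (matrix_inv M *v axis i 1) = 0"
      by simp
    then have "axis i (1::real) = 0"
      using matrix_inv_cancel(1)[of M] hurwitz
      by (simp add: matrix_vector_mul_assoc hurwitz_stable_invertible M_def)
    then show False
      by (simp add: axis_eq_0_iff)
  qed
  then show ?thesis
    unfolding min_ratio_def using bound by (subst Min_ge_iff) auto
qed

text \<open>If \<alpha> is not admissible, it is the endpoint \<open>alpha_max A\<close>. Every
  \<beta> between 0 and \<alpha> is then admissible, and the ratio bound, continuous in \<beta> on
  its left side, passes to the lower limit.\<close>

lemma component_le_gamma:
  assumes "u t0 \<le> \<theta>max" "t0 \<le> t" "hurwitz_stable A" and \<alpha>: "0 < \<alpha>" "\<alpha> \<le> alpha_max A"
  shows "ereal (u t $ i * exp (\<alpha> * (t - t0))) \<le> gamma A \<theta>max i \<alpha>"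
proof (cases "spectral_abscissa (transpose A + \<alpha> *\<^sub>R mat 1) < 0")
  case True
  then show ?thesis
    using component_le_min_ratio[OF assms(1,2)] by (simp add: gamma_def hurwitz_stable_shift_iff)
next
  case False
  have le: "\<forall>\<^sub>F \<beta> in at_left \<alpha>. ereal (u t $ i * exp (\<beta> * (t - t0))) \<le> ereal (min_ratio A \<theta>max i \<beta>)"
  proof (rule eventually_at_leftI[OF _ \<open>0 < \<alpha>\<close>])
    fix \<beta> assume "\<beta> \<in> {0<..<\<alpha>}"
    then have "hurwitz_stable (A + \<beta> *\<^sub>R mat 1)"
      using \<alpha>(2) by (simp add: hurwitz_stable_shift_iff spectral_abscissa_shift alpha_max_eq[OF assms(3)])
    then show "ereal (u t $ i * exp (\<beta> * (t - t0))) \<le> ereal (min_ratio A \<theta>max i \<beta>)"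
      using component_le_min_ratio[OF assms(1,2)] by simp
  qed
  have "((\<lambda>\<beta>. ereal (u t $ i * exp (\<beta> * (t - t0)))) \<longlongrightarrow> ereal (u t $ i * exp (\<alpha> * (t - t0)))) (at_left \<alpha>)"
    by (intro tendsto_intros)
  then have "ereal (u t $ i * exp (\<alpha> * (t - t0)))
      = Liminf (at_left \<alpha>) (\<lambda>\<beta>. ereal (u t $ i * exp (\<beta> * (t - t0))))"
    by (intro lim_imp_Liminf[symmetric]) (auto simp: trivial_limit_at_left_real)
  also have "\<dots> \<le> Liminf (at_left \<alpha>) (\<lambda>\<beta>. ereal (min_ratio A \<theta>max i \<beta>))"
    by (rule Liminf_mono[OF le])
  finally show ?thesis
    using False by (simp add: gamma_def)
qed

text \<open>If \<gamma> exceeds the component of \<delta>, the time bound says that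
  \<open>exp (\<alpha> * (t - t0))\<close> is at least their quotient; otherwise this factor is at
  least 1, which suffices.\<close>

lemma component_le_of_entry_time_at:
  assumes "u t0 \<le> \<theta>max" "t0 \<le> t" "hurwitz_stable A" and \<alpha>: "0 < \<alpha>" "\<alpha> \<le> alpha_max A"
    and "0 \<le> \<delta> $ i" and time: "entry_time_at A \<theta>max \<delta> i \<alpha> \<le> ereal (t - t0)"
  shows "u t $ i \<le> \<delta> $ i"
proof -
  have le: "ereal (u t $ i * exp (\<alpha> * (t - t0))) \<le> gamma A \<theta>max i \<alpha>"
    using assms by (intro component_le_gamma)
  show ?thesis
  proof (cases "gamma A \<theta>max i \<alpha> \<le> ereal (\<delta> $ i)")
    case True
    have "u t $ i * 1 \<le> u t $ i * exp (\<alpha> * (t - t0))"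
      using nonneg[OF \<open>t0 \<le> t\<close>] \<open>t0 \<le> t\<close> \<open>0 < \<alpha>\<close> by (intro mult_left_mono) auto
    also have "\<dots> \<le> \<delta> $ i"
      using order_trans[OF le True] by simp
    finally show ?thesis
      by simp
  next
    case False
    then have time': "- ereal (1 / \<alpha>) * ext_ln (ereal (\<delta> $ i) / gamma A \<theta>max i \<alpha>) \<le> ereal (t - t0)"
      using time by (simp add: entry_time_at_def)
    show ?thesis
    proof (cases "gamma A \<theta>max i \<alpha>")
      case (real g)
      then have g: "\<delta> $ i < g" "0 < g"
        using False \<open>0 \<le> \<delta> $ i\<close> by auto
      then have quot: "ereal (\<delta> $ i) / gamma A \<theta>max i \<alpha> = ereal (\<delta> $ i / g)"
        using real by simp
      \<comment> \<open>For \<open>\<delta> $ i = 0\<close> the value -\<infinity> of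
        \<open>ext_ln\<close> makes the entry time infinite, above \<open>t - t0\<close>.\<close>
      have "0 < \<delta> $ i"
      proof (rule ccontr)
        assume "\<not> 0 < \<delta> $ i"
        then have "\<delta> $ i / g = 0"
          using \<open>0 \<le> \<delta> $ i\<close> by simp
        then show False
          using time' \<open>0 < \<alpha>\<close> unfolding quot \<open>\<delta> $ i / g = 0\<close> by (simp add: ext_ln_def)
      qed
      then have pos: "0 < \<delta> $ i / g"
        using g by simp
      then have "- (1 / \<alpha>) * ln (\<delta> $ i / g) \<le> t - t0"
        using time' unfolding quot by (simp add: ext_ln_def)
      then have "- ln (\<delta> $ i / g) \<le> \<alpha> * (t - t0)"
        using \<open>0 < \<alpha>\<close> by (simp add: field_simps)
      then have "exp (- ln (\<delta> $ i / g)) \<le> exp (\<alpha> * (t - t0))"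
        by simp
      then have "g / \<delta> $ i \<le> exp (\<alpha> * (t - t0))"
        using pos by (simp add: exp_minus)
      then have "u t $ i * (g / \<delta> $ i) \<le> u t $ i * exp (\<alpha> * (t - t0))"
        using nonneg[OF \<open>t0 \<le> t\<close>] by (intro mult_left_mono) auto
      also have "\<dots> \<le> g"
        using le real by simp
      finally show ?thesis
        using g \<open>0 < \<delta> $ i\<close> by (simp add: field_simps)
    next
      \<comment> \<open>Division by \<infinity> gives 0, so the entry time is again
        infinite.\<close>
      case PInf
      then show ?thesis
        using time' \<open>0 < \<alpha>\<close> by (simp add: ext_ln_def)
    next
      case MInf
      then show ?thesis
        using le by simp
    qed
  qed
qed

end

section \<open>The entry time\<close>

text \<open>In the logarithmic case the quotient is below 1. The bound later yields
  \<open>t0 \<le> t\<close>.\<close>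

lemma entry_time_at_nonneg:
  assumes "0 < \<alpha>" "0 \<le> \<delta> $ i"
  shows "0 \<le> entry_time_at A \<theta>max \<delta> i \<alpha>"
proof (cases "gamma A \<theta>max i \<alpha>")
  case (real g)
  show ?thesis
  proof (cases "g \<le> \<delta> $ i \<or> \<delta> $ i = 0")
    case True
    then show ?thesis
      using assms real by (auto simp: entry_time_at_def ext_ln_def)
  next
    case False
    then have "ln (\<delta> $ i / g) \<le> 0"
      using assms by simp
    moreover have "0 < \<delta> $ i / g"
      using False assms by simp
    ultimately show ?thesis
      using False assms real by (simp add: entry_time_at_def ext_ln_def divide_nonpos_pos)
  qed
qed (use assms in \<open>auto simp: entry_time_at_def ext_ln_def\<close>)

lemma entry_time_comp_nonneg:
  assumes "0 \<le> \<delta> $ i"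
  shows "0 \<le> entry_time_comp A \<theta>max \<delta> i"
  unfolding entry_time_comp_def using assms by (auto intro!: INF_greatest entry_time_at_nonneg)

lemma entry_time_comp_le: "entry_time_comp A \<theta>max \<delta> i \<le> entry_time A \<theta>max \<delta>"
  by (simp add: entry_time_def)

text \<open>One interior \<alpha> suffices: half of \<open>alpha_max A\<close> is admissible, so
  \<open>gamma\<close> is a real ratio there, and \<open>0 < \<delta> $ i\<close> keeps the
  logarithm finite.\<close>

lemma entry_time_comp_finite:
  assumes "hurwitz_stable A" "0 < \<delta> $ i"
  shows "entry_time_comp A \<theta>max \<delta> i < \<infinity>"
proof -
  define \<alpha> where "\<alpha> = alpha_max A / 2"
  have \<alpha>: "0 < \<alpha>" "\<alpha> < alpha_max A"
    using assms by (simp_all add: \<alpha>_def alpha_max_eq hurwitz_stable_iff_spectral_abscissa)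
  then have "gamma A \<theta>max i \<alpha> = ereal (min_ratio A \<theta>max i \<alpha>)"
    using assms by (simp add: gamma_def spectral_abscissa_shift alpha_max_eq)
  then have "entry_time_at A \<theta>max \<delta> i \<alpha> < \<infinity>"
    using assms by (auto simp: entry_time_at_def ext_ln_def divide_le_0_iff)
  moreover have "entry_time_comp A \<theta>max \<delta> i \<le> entry_time_at A \<theta>max \<delta> i \<alpha>"
    unfolding entry_time_comp_def using \<alpha> by (intro INF_lower) auto
  ultimately show ?thesis
    by (rule le_less_trans[rotated])
qed

text \<open>Finiteness is claimed for positive \<delta>, as a zero component can make the time
  infinite.\<close>

theorem theorem1:
  fixes A :: "real ^ 'n ^ 'n" and \<theta>max \<delta> :: "real ^ 'n" and t0 :: real
  assumes "metzler A" and "hurwitz_stable A"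
    and "0 \<le> \<theta>max" and "0 \<le> \<delta>" and "0 \<le> t0"
  shows "((\<forall>i. 0 < \<delta> $ i) \<longrightarrow> entry_time A \<theta>max \<delta> < \<infinity>) \<and>
    (\<forall>\<theta> u. 0 \<le> \<theta> \<and> \<theta> \<le> \<theta>max \<and> u t0 = \<theta> \<and>
        (\<forall>t \<ge> t0. (u has_vector_derivative A *v u t) (at t within {t0..})) \<longrightarrow>
        (\<forall>t. ereal t \<ge> ereal t0 + entry_time A \<theta>max \<delta> \<longrightarrow> u t \<in> {0..\<delta>}))"
proof (intro conjI allI impI)
  assume "\<forall>i. 0 < \<delta> $ i"
  then show "entry_time A \<theta>max \<delta> < \<infinity>"
    unfolding entry_time_def
    using entry_time_comp_finite[OF \<open>hurwitz_stable A\<close>] by (subst Max_less_iff) auto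
next
  fix \<theta> u t
  assume u: "0 \<le> \<theta> \<and> \<theta> \<le> \<theta>max \<and> u t0 = \<theta> \<and>
      (\<forall>t \<ge> t0. (u has_vector_derivative A *v u t) (at t within {t0..}))"
    and t: "ereal t \<ge> ereal t0 + entry_time A \<theta>max \<delta>"
  interpret positive_trajectory A u t0
    using u \<open>metzler A\<close> by unfold_locales auto
  have \<delta>: "0 \<le> \<delta> $ i" for i
    using \<open>0 \<le> \<delta>\<close> by (simp add: less_eq_vec_def)
  have comp: "entry_time_comp A \<theta>max \<delta> i \<le> ereal (t - t0)" for i
    using t entry_time_comp_le[of A \<theta>max \<delta> i]
    by (cases "entry_time A \<theta>max \<delta>"; cases "entry_time_comp A \<theta>max \<delta> i") auto
  have "t0 \<le> t"
    using order_trans[OF entry_time_comp_nonneg comp] \<delta> by simp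
  have "u t $ i \<le> \<delta> $ i" for i
  proof -
    have later: "u s $ i \<le> \<delta> $ i" if "t < s" for s
    proof -
      \<comment> \<open>Strictness yields an \<alpha> whose entry time is below
        \<open>s - t0\<close>, even if the infimum is not attained.\<close>
      have "entry_time_comp A \<theta>max \<delta> i < ereal (s - t0)"
        using comp[of i] that by (auto intro: le_less_trans)
      then obtain \<alpha> where "\<alpha> \<in> {0<..alpha_max A}" "entry_time_at A \<theta>max \<delta> i \<alpha> < ereal (s - t0)"
        by (auto simp: entry_time_comp_def INF_less_iff)
      then show ?thesis
        using u \<open>t0 \<le> t\<close> that \<open>hurwitz_stable A\<close> \<delta>
        by (intro component_le_of_entry_time_at[of \<theta>max s \<alpha>]) auto
    qed
    have "(u \<longlongrightarrow> u t) (at t within {t0..})"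
      using continuous_on_u \<open>t0 \<le> t\<close> by (simp add: continuous_on_def)
    then have "(u \<longlongrightarrow> u t) (at_right t)"
      by (rule tendsto_within_subset) (use \<open>t0 \<le> t\<close> in auto)
    then have "((\<lambda>s. u s $ i) \<longlongrightarrow> u t $ i) (at_right t)"
      by (rule tendsto_vec_nth)
    then show ?thesis
      by (rule tendsto_upperbound) (auto simp: eventually_at_filter later)
  qed
  then show "u t \<in> {0..\<delta>}"
    using nonneg[OF \<open>t0 \<le> t\<close>] by (simp add: less_eq_vec_def)
qed

end
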